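(* Let $G=(V,E)$ be a strongly connected bidirected graph, let $\mathcal{T}$ be a separator decomposition of $G$, let $\pi$ be a nested dissection order induced by $\mathcal{T}$ with $\mathrm{Rank}(v)=\pi^{-1}(v)$, and let $H$ be the graph obtained by contracting the vertices of $G$ in the order $\pi$. Let $X$ be a node of $\mathcal{T}$, let $G_X$ be the subgraph of $G$ induced by the vertices contained in the subtree $\mathcal{T}_X$, let $B(X)=\{w\in V\setminus V(G_X) : (v,w)\in E \text{ for some } v\in V(G_X)\}$, and let $u$ be the highest-ranked vertex of $G_X$. Then $B(X)=N_H^{\uparrow}(u)$.
   Context: A graph $G=(V,E)$ is bidirected if $(v,w)\in E$ implies $(w,v)\in E$. A separator decomposition of a strongly connected $n$-vertex bidirected graph $G=(V,E)$ is a rooted tree $\mathcal{T}=(\mathcal{X},\mathcal{E})$ whose nodes $X\in\mathcal{X}$ are pairwise disjoint subsets of $V$, defined recursively: if $n=1$, $\mathcal{T}$ is a single node $X=V$; if $n>1$, $\mathcal{T}$ has a root $X\subseteq V$ such that removing $X$ separates $G$ into strongly connected subgraphs $G_0,\dots,G_{d-1}$ (with no edges of $G$ between different $G_i$), and the children of the root are the roots of separator decompositions of $G_0,\dots,G_{d-1}$. For a node $X$, $\mathcal{T}_X$ denotes the subtree rooted at $X$ and $G_X$ the subgraph of $G$ induced by all vertices contained in nodes of $\mathcal{T}_X$. A nested dissection order $\pi$ induced by $\mathcal{T}$ is obtained by numbering the vertices in the order in which they are visited by a postorder walk of $\mathcal{T}$, where the vertices within each node are visited in an arbitrary order; $\pi^{-1}(v)$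 is the rank of $v$. Contraction: vertices are processed in increasing rank; to contract a vertex $v$, it is temporarily removed from the current graph and shortcut edges are added between every pair of its remaining (not yet contracted) neighbors. $H$ is the graph consisting of $G$ together with all shortcuts added. $N_H^{\uparrow}(v)$ is the set of neighbors of $v$ in $H$ whose rank is higher than that of $v$. *)

theory Defs
  imports "Graph_Theory.Digraph_Component" "HOL-Library.Multiset"
begin

section \<open>Separator decompositions\<close>

datatype (nodes: 'x) rtree = Node 'x "'x rtree list"

fun subtrees :: "'x rtree \<Rightarrow> 'x rtree set" where
  "subtrees (Node x ts) = insert (Node x ts) (\<Union>t\<in>set ts. subtrees t)"

definition separates_into ::
  "('a, 'b) pre_digraph \<Rightarrow> 'a set \<Rightarrow> ('a, 'b) pre_digraph list \<Rightarrow> bool" where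
  "separates_into G X Gs \<longleftrightarrow>
     (\<forall>H\<in>set Gs. induced_subgraph H G \<and> strongly_connected H) \<and>
     (\<Union>H\<in>set Gs. verts H) = verts G - X \<and>
     (\<forall>i<length Gs. \<forall>j<length Gs. i \<noteq> j \<longrightarrow>
        verts (Gs ! i) \<inter> verts (Gs ! j) = {} \<and>
        (\<forall>v\<in>verts (Gs ! i). \<forall>w\<in>verts (Gs ! j). \<not> v \<rightarrow>\<^bsub>G\<^esub> w))"

text \<open>
  No lower bound is put on the number of subgraphs: the root may contain all vertices
  (no subgraph) or no vertex (a single subgraph, the graph itself).
\<close>

inductive separator_decomposition :: "('a, 'b) pre_digraph \<Rightarrow> 'a set rtree \<Rightarrow> bool" where
  single: "card (verts G) = 1 \<Longrightarrow> separator_decomposition G (Node (verts G) [])"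
| split: "card (verts G) > 1 \<Longrightarrow> X \<subseteq> verts G \<Longrightarrow> separates_into G X Gs \<Longrightarrow>
    list_all2 separator_decomposition Gs ts \<Longrightarrow> separator_decomposition G (Node X ts)"

definition subtree_graph :: "('a, 'b) pre_digraph \<Rightarrow> 'a set rtree \<Rightarrow> ('a, 'b) pre_digraph" where
  "subtree_graph G S = G \<restriction> \<Union>(nodes S)"

definition boundary :: "'a pair_pre_digraph \<Rightarrow> 'a set rtree \<Rightarrow> 'a set" where
  "boundary G S = {w \<in> pverts G - verts (subtree_graph G S).
     \<exists>v\<in>verts (subtree_graph G S). (v, w) \<in> parcs G}"

section \<open>Nested dissection orders\<close>

text \<open>
  An order is the list of vertices by increasing rank. Separator decompositions are unordered
  trees, so a postorder walk may visit the children of a node in any order \<open>us\<close>.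
\<close>

inductive nested_dissection_order :: "'a set rtree \<Rightarrow> 'a list \<Rightarrow> bool" where
  "mset us = mset ts \<Longrightarrow> list_all2 nested_dissection_order us ps \<Longrightarrow>
   distinct xs \<Longrightarrow> set xs = X \<Longrightarrow> nested_dissection_order (Node X ts) (concat ps @ xs)"

definition Rank :: "'a list \<Rightarrow> 'a \<Rightarrow> nat" where
  "Rank \<pi> v = inv_into {..<length \<pi>} (\<lambda>i. \<pi> ! i) v"

section \<open>Contraction\<close>

text \<open>In a bidirected graph the out-neighbours are all the neighbours.\<close>

definition neighbors :: "'a pair_pre_digraph \<Rightarrow> 'a \<Rightarrow> 'a set" where
  "neighbors G v = {w. (v, w) \<in> parcs G}"

definition shortcuts :: "'a pair_pre_digraph \<Rightarrow> 'a \<Rightarrow> ('a \<times> 'a) set" where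
  "shortcuts G v = {(x, y). x \<in> neighbors G v - {v} \<and> y \<in> neighbors G v - {v} \<and> x \<noteq> y}"

definition contract_vertex :: "'a pair_pre_digraph \<Rightarrow> 'a \<Rightarrow> 'a pair_pre_digraph" where
  "contract_vertex G v =
     \<lparr>pverts = pverts G - {v},
      parcs = {(x, y) \<in> parcs G. x \<noteq> v \<and> y \<noteq> v} \<union> shortcuts G v\<rparr>"

primrec all_shortcuts :: "'a pair_pre_digraph \<Rightarrow> 'a list \<Rightarrow> ('a \<times> 'a) set" where
  "all_shortcuts G [] = {}"
| "all_shortcuts G (v # vs) = shortcuts G v \<union> all_shortcuts (contract_vertex G v) vs"

definition contraction_graph :: "'a pair_pre_digraph \<Rightarrow> 'a list \<Rightarrow> 'a pair_pre_digraph" where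
  "contraction_graph G \<pi> = \<lparr>pverts = pverts G, parcs = parcs G \<union> all_shortcuts G \<pi>\<rparr>"

definition up_neighbors :: "'a pair_pre_digraph \<Rightarrow> 'a list \<Rightarrow> 'a \<Rightarrow> 'a set" where
  "up_neighbors H \<pi> v = {w \<in> neighbors H v. Rank \<pi> v < Rank \<pi> w}"

end

theory Submission
  imports Defs "HOL-Combinatorics.Permutations"
begin

text \<open>
  Every arc leaving \<open>G\<^sub>X\<close> ends in an ancestor node, hence in a vertex ranked above all of \<open>G\<^sub>X\<close>.
  Contracting the vertices ranked below \<open>u\<close> therefore never removes a vertex of \<open>B(X)\<close>, and it
  preserves two properties of the remaining part \<open>P\<close> of \<open>G\<^sub>X\<close>: all arcs from \<open>P\<close> lead to
  \<open>P \<union> B(X)\<close>, and for each \<open>w \<in> B(X)\<close> every nonempty \<open>A \<subseteq> P\<close> has an arc to \<open>(P \<union> {w}) - A\<close>.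
  When only \<open>P = {u}\<close> is left, they say that the neighbours of \<open>u\<close> other than \<open>u\<close> itself are
  exactly the vertices of \<open>B(X)\<close>.
\<close>

section \<open>Contraction of a region\<close>

text \<open>For \<open>w\<close> outside \<open>P\<close>, the last clause is the cut form of "every
  vertex of \<open>P\<close> has a path to \<open>w\<close> whose inner vertices lie in
  \<open>P\<close>". Cuts need no path surgery when a vertex is contracted.\<close>

definition enclosed :: "'a pair_pre_digraph \<Rightarrow> 'a set \<Rightarrow> 'a set \<Rightarrow> bool" where
  "enclosed G P B \<longleftrightarrow> sym (parcs G) \<and>
     (\<forall>x\<in>P. neighbors G x \<subseteq> P \<union> B) \<and>
     (\<forall>w\<in>B. \<forall>A\<subseteq>P. A \<noteq> {} \<longrightarrow> (\<exists>a\<in>A. \<exists>x\<in>insert w P - A. (a, x) \<in> parcs G))"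

text \<open>A shortcut from \<open>P\<close> replaces a path through \<open>v\<close>; such a
  \<open>v\<close> lies in \<open>P\<close> because it is not in \<open>B\<close>, so its neighbors
  stay in \<open>P \<union> B\<close>. A cut arc that is lost by ending in \<open>v\<close> is
  recovered from the cut with \<open>v\<close> added.\<close>

lemma enclosed_contract_vertex:
  assumes enc: "enclosed G P B" and "v \<notin> B"
  shows "enclosed (contract_vertex G v) (P - {v}) B"
  unfolding enclosed_def
proof (intro conjI ballI allI impI)
  have sym: "(y, x) \<in> parcs G" if "(x, y) \<in> parcs G" for x y
    using enc that by (auto simp: enclosed_def dest: symD)
  have nb: "y \<in> P \<union> B" if "x \<in> P" "(x, y) \<in> parcs G" for x y
    using enc that by (auto simp: enclosed_def neighbors_def)
  have cut: "\<exists>a\<in>A. \<exists>x\<in>insert w P - A. (a, x) \<in> parcs G"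
    if "w \<in> B" "A \<subseteq> P" "A \<noteq> {}" for w A
    using enc that by (auto simp: enclosed_def)
  show "sym (parcs (contract_vertex G v))"
    by (rule symI) (auto simp: contract_vertex_def shortcuts_def intro: sym)
  show "neighbors (contract_vertex G v) x \<subseteq> P - {v} \<union> B" if "x \<in> P - {v}" for x
  proof
    fix y assume "y \<in> neighbors (contract_vertex G v) x"
    then consider "(x, y) \<in> parcs G" "y \<noteq> v"
      | "(v, x) \<in> parcs G" "(v, y) \<in> parcs G" "y \<noteq> v"
      by (auto simp: neighbors_def contract_vertex_def shortcuts_def)
    then show "y \<in> P - {v} \<union> B"
    proof cases
      case 1
      then show ?thesis
        using nb[of x y] that by auto
    next
      case 2
      then have "v \<in> P"
        using nb[of x v] sym that \<open>v \<notin> B\<close> by auto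
      then show ?thesis
        using nb[of v y] 2 by auto
    qed
  qed
  fix w A
  assume w: "w \<in> B" and A: "A \<subseteq> P - {v}" "A \<noteq> {}"
  obtain a x where ax: "a \<in> A" "x \<in> insert w P - A" "(a, x) \<in> parcs G"
    using cut[OF w, of A] A by blast
  show "\<exists>a\<in>A. \<exists>x\<in>insert w (P - {v}) - A. (a, x) \<in> parcs (contract_vertex G v)"
  proof (cases "x = v")
    case False
    then have "(a, x) \<in> parcs (contract_vertex G v)"
      using ax A by (auto simp: contract_vertex_def)
    then show ?thesis
      using ax False by blast
  next
    case True
    then have "v \<in> P"
      using ax w \<open>v \<notin> B\<close> by auto
    \<comment> \<open>Apply the cut property to \<open>insert v A\<close>. If the arc starts in
      \<open>v\<close>, then \<open>a\<close>, \<open>v\<close>, \<open>y\<close> yield the shortcut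
      \<open>(a, y)\<close>, with \<open>a \<noteq> y\<close> since \<open>y\<close> is outside
      \<open>A\<close>; otherwise it starts in \<open>A\<close> and avoids \<open>v\<close>, so it
      survives.\<close>
    then obtain b y where edge: "b \<in> insert v A" "y \<in> insert w P - insert v A" "(b, y) \<in> parcs G"
      using cut[OF w, of "insert v A"] A by blast
    show ?thesis
    proof (cases "b = v")
      case True
      then have "(a, y) \<in> parcs (contract_vertex G v)"
        using ax edge \<open>x = v\<close> A sym[OF ax(3)]
        by (auto simp: contract_vertex_def shortcuts_def neighbors_def)
      then show ?thesis
        using ax edge by blast
    next
      case False
      then have "(b, y) \<in> parcs (contract_vertex G v)"
        using edge A by (auto simp: contract_vertex_def)
      then show ?thesis
        using edge False by blast
    qed
  qed
qed

lemma enclosed_foldl_contract_vertex: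
  assumes "enclosed G P B" "set vs \<inter> B = {}"
  shows "enclosed (foldl contract_vertex G vs) (P - set vs) B"
  using assms
proof (induction vs arbitrary: G P)
  case (Cons v vs)
  then have "enclosed (foldl contract_vertex (contract_vertex G v) vs) (P - {v} - set vs) B"
    using Cons.IH[OF enclosed_contract_vertex] by simp
  then show ?case
    by (simp add: Diff_insert2[of P v "set vs"])
qed simp

text \<open>The only cut left is \<open>{u}\<close>, and its arc can end only in \<open>w\<close>.
  Loops are allowed, hence the removal of \<open>u\<close>.\<close>

lemma enclosed_singleton:
  assumes "enclosed G {u} B" "u \<notin> B"
  shows "neighbors G u - {u} = B"
proof
  show "neighbors G u - {u} \<subseteq> B"
    using assms by (auto simp: enclosed_def)
  show "B \<subseteq> neighbors G u - {u}"
  proof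
    fix w assume "w \<in> B"
    then have "\<exists>a\<in>{u}. \<exists>x\<in>insert w {u} - {u}. (a, x) \<in> parcs G"
      using assms(1) unfolding enclosed_def by blast
    then show "w \<in> neighbors G u - {u}"
      using assms(2) \<open>w \<in> B\<close> by (auto simp: neighbors_def)
  qed
qed

section \<open>Arcs of the contraction graph at a given vertex\<close>

lemma all_shortcuts_isolated:
  assumes "\<forall>y. (u, y) \<notin> parcs G" "\<forall>x. (x, u) \<notin> parcs G"
  shows "(u, w) \<notin> all_shortcuts G vs"
  using assms
proof (induction vs arbitrary: G)
  case (Cons v vs)
  then have "(u, w) \<notin> all_shortcuts (contract_vertex G v) vs"
    by (intro Cons.IH) (auto simp: contract_vertex_def shortcuts_def neighbors_def)
  with Cons.prems show ?case
    by (auto simp: shortcuts_def neighbors_def)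
qed simp

text \<open>Shortcuts between \<open>u\<close> and an uncontracted \<open>w\<close> arise only
  before \<open>u\<close> is contracted, and they persist until then. Contracting \<open>u\<close>
  adds no arc at \<open>u\<close> and isolates it, so nothing is added later.\<close>

lemma contraction_graph_arc_iff:
  assumes "u \<notin> set vs" "w \<notin> set vs"
  shows "(u, w) \<in> parcs (contraction_graph G (vs @ u # cs)) \<longleftrightarrow>
    (u, w) \<in> parcs (foldl contract_vertex G vs)"
  using assms
proof (induction vs arbitrary: G)
  case Nil
  have "(u, w) \<notin> all_shortcuts (contract_vertex G u) cs"
    by (rule all_shortcuts_isolated) (auto simp: contract_vertex_def shortcuts_def)
  then show ?case
    by (auto simp: contraction_graph_def shortcuts_def)
next
  case (Cons v vs)
  have "(u, w) \<in> parcs (contraction_graph G ((v # vs) @ u # cs)) \<longleftrightarrow>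
      (u, w) \<in> parcs (contraction_graph (contract_vertex G v) (vs @ u # cs))"
    using Cons.prems by (auto simp: contraction_graph_def contract_vertex_def)
  with Cons show ?case
    by simp
qed

section \<open>Ranks\<close>

lemma Rank_nth:
  assumes "distinct \<pi>" "i < length \<pi>"
  shows "Rank \<pi> (\<pi> ! i) = i"
  unfolding Rank_def using assms by (intro inv_into_f_f) (auto intro: inj_on_nth)

lemma Rank_less_append:
  assumes "distinct (xs @ ys)" "x \<in> set xs" "y \<in> set ys"
  shows "Rank (xs @ ys) x < Rank (xs @ ys) y"
proof -
  obtain i j where i: "i < length xs" "x = xs ! i" and j: "j < length ys" "y = ys ! j"
    using assms by (auto simp: in_set_conv_nth)
  have "Rank (xs @ ys) x = i"
    using Rank_nth[OF assms(1), of i] i by (simp add: nth_append)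
  moreover have "Rank (xs @ ys) y = length xs + j"
    using Rank_nth[OF assms(1), of "length xs + j"] j by simp
  ultimately show ?thesis
    using i by simp
qed

section \<open>Separator decompositions and their orders\<close>

text \<open>The cut form of strong connectivity of the subgraph induced by \<open>P\<close>. It
  matches the last clause of \<open>enclosed\<close> and passes from a subgraph to the whole graph
  with \<open>P\<close> fixed.\<close>

definition linked :: "('a, 'b) pre_digraph \<Rightarrow> 'a set \<Rightarrow> bool" where
  "linked G P \<longleftrightarrow> (\<forall>A. A \<noteq> {} \<longrightarrow> A \<subset> P \<longrightarrow> (\<exists>a\<in>A. \<exists>x\<in>P - A. a \<rightarrow>\<^bsub>G\<^esub> x))"

lemma linked_mono:
  assumes "linked H P" "subgraph H G"
  shows "linked G P"
  unfolding linked_def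
proof (intro allI impI)
  fix A assume "A \<noteq> {}" "A \<subset> P"
  then obtain a x where "a \<in> A" "x \<in> P - A" "a \<rightarrow>\<^bsub>H\<^esub> x"
    using assms(1) unfolding linked_def by meson
  then show "\<exists>a\<in>A. \<exists>x\<in>P - A. a \<rightarrow>\<^bsub>G\<^esub> x"
    using arcs_ends_mono[OF assms(2)] by blast
qed

lemma strongly_connected_imp_linked:
  assumes "wf_digraph G" "strongly_connected G"
  shows "linked G (verts G)"
  unfolding linked_def
proof (intro allI impI)
  interpret wf_digraph G
    by fact
  fix A assume A: "A \<noteq> {}" "A \<subset> verts G"
  then obtain a b where ab: "a \<in> A" "b \<in> verts G - A"
    by blast
  then have "a \<rightarrow>\<^sup>*\<^bsub>G\<^esub> b"
    using assms A unfolding strongly_connected_def by blast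
  \<comment> \<open>Invariant along the path from \<open>a\<close>: its current end is still in
    \<open>A\<close>, or an arc leaving \<open>A\<close> has already been passed.\<close>
  then have "b \<notin> A \<longrightarrow> (\<exists>a\<in>A. \<exists>x\<in>verts G - A. a \<rightarrow>\<^bsub>G\<^esub> x)"
    by (induction rule: reachable_induct) (use ab adj_in_verts in blast)+
  then show "\<exists>a\<in>A. \<exists>x\<in>verts G - A. a \<rightarrow>\<^bsub>G\<^esub> x"
    using ab by blast
qed

lemma induced_subgraph_adj:
  assumes "induced_subgraph H G" "v \<in> verts H" "w \<in> verts H" "v \<rightarrow>\<^bsub>G\<^esub> w"
  shows "v \<rightarrow>\<^bsub>H\<^esub> w"
  using assms
  by (force simp: induced_subgraph_def subgraph_def compatible_def arcs_ends_conv)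

section \<open>Reordering the children of a node\<close>

lemma separates_into_mset_cong:
  assumes "separates_into G X Gs" "mset Hs = mset Gs"
  shows "separates_into G X Hs"
proof -
  obtain p where p: "p permutes {..<length Gs}" "permute_list p Gs = Hs"
    using mset_eq_permutation[OF assms(2)] .
  have len: "length Hs = length Gs" and set: "set Hs = set Gs"
    using assms(2) by (auto dest: mset_eq_length mset_eq_setD)
  have "Hs ! i = Gs ! p i" "p i < length Gs" if "i < length Gs" for i
    using p that permute_list_nth[OF p(1)] permutes_in_image[OF p(1), of i] by auto
  \<comment> \<open>Injectivity keeps distinct positions distinct, so the pairwise conditions carry
    over.\<close>
  moreover have "p i \<noteq> p j" if "i \<noteq> j" for i j
    using that permutes_inj[OF p(1)] by (auto dest: injD)
  ultimately show ?thesis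
    using assms(1) unfolding separates_into_def set len by metis
qed

text \<open>Lists the subgraphs in the order in which the walk visits the children, so that
  subgraph, child and block of the order share an index. With \<open>R\<close> containing the
  induction hypothesis, that is reordered too.\<close>

lemma separates_into_reorder:
  assumes "separates_into G X Gs" "list_all2 R Gs ts" "mset us = mset ts"
  obtains Hs where "separates_into G X Hs" "list_all2 R Hs us"
proof -
  have "list_all2 (\<lambda>t H. R H t) ts Gs"
    using assms(2) by (simp add: list_all2_conv_all_nth)
  then obtain Hs where "list_all2 (\<lambda>t H. R H t) us Hs" "mset Hs = mset Gs"
    using list_all2_reorder_left_invariance assms(3) by blast
  then show ?thesis
    using that[of Hs] separates_into_mset_cong[OF assms(1)] by (simp add: list_all2_conv_all_nth)
qed

section \<open>Vertex sets and distinctness of nested dissection orders\<close>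

lemma Union_nodes_separator_decomposition:
  "separator_decomposition G T \<Longrightarrow> \<Union>(nodes T) = verts G"
proof (induction rule: separator_decomposition.induct)
  case (split G X Gs ts)
  have "(\<Union>t\<in>set ts. \<Union>(nodes t)) = (\<Union>H\<in>set Gs. verts H)"
    using split.IH by (induction rule: list_all2_induct) auto
  moreover have "(\<Union>H\<in>set Gs. verts H) = verts G - X"
    using split.hyps(3) unfolding separates_into_def by blast
  moreover have "\<Union>(nodes (Node X ts)) = X \<union> (\<Union>t\<in>set ts. \<Union>(nodes t))"
    by auto
  ultimately show ?case
    using split.hyps(2) by (metis Diff_partition)
qed simp

lemma set_nested_dissection_order:
  "nested_dissection_order T \<pi> \<Longrightarrow> set \<pi> = \<Union>(nodes T)"
proof (induction rule: nested_dissection_order.induct)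
  case (1 us ts ps xs X)
  have "(\<Union>p\<in>set ps. set p) = (\<Union>t\<in>set us. \<Union>(nodes t))"
    using "1.IH" by (induction rule: list_all2_induct) auto
  then show ?case
    using "1.hyps" mset_eq_setD[OF "1.hyps"(1)] by auto
qed

lemma distinct_concat_nth:
  assumes "\<And>i. i < length ps \<Longrightarrow> distinct (ps ! i)"
    and "\<And>i j. i < length ps \<Longrightarrow> j < length ps \<Longrightarrow> i \<noteq> j \<Longrightarrow> set (ps ! i) \<inter> set (ps ! j) = {}"
  shows "distinct (concat ps)"
  using assms
proof (induction ps)
  case (Cons p ps)
  have "distinct (concat ps)"
    using Cons.prems(1)[of "Suc _"] Cons.prems(2)[of "Suc _" "Suc _"] by (intro Cons.IH) auto
  moreover have "set p \<inter> set q = {}" if "q \<in> set ps" for q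
    using that Cons.prems(2)[of 0 "Suc _"] by (auto simp: in_set_conv_nth)
  ultimately show ?case
    using Cons.prems(1)[of 0] by auto
qed simp

text \<open>The block of each child enumerates the vertices of its subgraph; these sets are pairwise
  disjoint and avoid the separator.\<close>

lemma distinct_nested_dissection_order:
  "separator_decomposition G T \<Longrightarrow> nested_dissection_order T \<pi> \<Longrightarrow> distinct \<pi>"
proof (induction arbitrary: \<pi> rule: separator_decomposition.induct)
  case (single G)
  from single.prems show ?case
    by cases auto
next
  case (split G X Gs ts)
  from split.prems show ?case
  proof cases
    case (1 us ps xs)
    obtain Hs where Hs: "separates_into G X Hs"
      "list_all2 (\<lambda>H t. separator_decomposition H t \<and>
         (\<forall>\<pi>. nested_dissection_order t \<pi> \<longrightarrow> distinct \<pi>)) Hs us"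
      using separates_into_reorder[OF split.hyps(3) split.IH 1(2)] by blast
    have len: "length Hs = length us" "length ps = length us"
      using Hs(2) 1(3) by (auto dest: list_all2_lengthD)
    have ps: "set (ps ! i) = verts (Hs ! i)" "distinct (ps ! i)" if "i < length us" for i
      using that len list_all2_nthD2[OF Hs(2) that] list_all2_nthD[OF 1(3) that]
        Union_nodes_separator_decomposition set_nested_dissection_order by blast+
    have "distinct (concat ps)"
      using ps len Hs(1) by (intro distinct_concat_nth) (auto simp: separates_into_def)
    moreover have "set p \<inter> X = {}" if "p \<in> set ps" for p
    proof -
      obtain i where i: "i < length us" "p = ps ! i"
        using \<open>p \<in> set ps\<close> len by (auto simp: in_set_conv_nth)
      then have "verts (Hs ! i) \<subseteq> verts G - X"
        using Hs(1) len by (auto simp: separates_into_def)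
      then show ?thesis
        using ps i by auto
    qed
    ultimately show ?thesis
      using 1 by auto
  qed
qed

text \<open>A postorder walk visits a subtree in one contiguous block \<open>ps\<close>. Going up
  the tree, an arc leaving a child's subgraph cannot enter a sibling's, so it ends in the separator
  \<open>X\<close>, which is listed after all children.\<close>

lemma nested_dissection_order_split:
  assumes "separator_decomposition G T" "nested_dissection_order T \<pi>" "S \<in> subtrees T"
    and "wf_digraph G" "strongly_connected G"
  shows "\<exists>as ps cs. \<pi> = as @ ps @ cs \<and> set ps = \<Union>(nodes S) \<and> linked G (set ps) \<and>
    (\<forall>v\<in>set ps. \<forall>w\<in>verts G - set ps. v \<rightarrow>\<^bsub>G\<^esub> w \<longrightarrow> w \<in> set cs)"
  using assms
proof (induction arbitrary: \<pi> rule: separator_decomposition.induct)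
  case (single G)
  then have "S = Node (verts G) []" "set \<pi> = verts G"
    using set_nested_dissection_order by fastforce+
  then show ?case
    using strongly_connected_imp_linked single.prems
    by (intro exI[of _ "[]"] exI[of _ \<pi>]) auto
next
  case (split G X Gs ts)
  show ?case
  proof (cases "S = Node X ts")
    case True
    \<comment> \<open>Here \<open>S\<close> is the whole tree: the block is all of
      \<open>\<pi>\<close>, and no vertex of \<open>G\<close> lies outside it.\<close>
    have "separator_decomposition G S"
      using split.hyps split.IH True
      by (auto intro!: separator_decomposition.split elim: list_all2_mono)
    then have "set \<pi> = verts G" "\<Union>(nodes S) = verts G"
      using split.prems(1) True set_nested_dissection_order
        Union_nodes_separator_decomposition by blast+
    then show ?thesis
      using strongly_connected_imp_linked split.prems
      by (intro exI[of _ "[]"] exI[of _ \<pi>]) auto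
  next
    case False
    from split.prems(1) show ?thesis
    proof cases
      case (1 us qs xs)
      obtain Hs where Hs: "separates_into G X Hs"
        "list_all2 (\<lambda>H t. separator_decomposition H t \<and>
           (\<forall>\<pi>. nested_dissection_order t \<pi> \<longrightarrow> S \<in> subtrees t \<longrightarrow> wf_digraph H \<longrightarrow>
             strongly_connected H \<longrightarrow>
             (\<exists>as ps cs. \<pi> = as @ ps @ cs \<and> set ps = \<Union>(nodes S) \<and> linked H (set ps) \<and>
               (\<forall>v\<in>set ps. \<forall>w\<in>verts H - set ps. v \<rightarrow>\<^bsub>H\<^esub> w \<longrightarrow> w \<in> set cs)))) Hs us"
        using separates_into_reorder[OF split.hyps(3) split.IH 1(2)] by blast
      have len: "length Hs = length us" "length qs = length us"
        using Hs(2) 1(3) by (auto dest: list_all2_lengthD)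
      obtain i where i: "i < length us" "S \<in> subtrees (us ! i)"
      proof -
        have "\<exists>t\<in>set us. S \<in> subtrees t"
          using False split.prems(2) mset_eq_setD[OF 1(2)] by auto
        then show thesis
          using that by (auto simp: in_set_conv_nth)
      qed
      define H where "H = Hs ! i"
      have H: "induced_subgraph H G" "subgraph H G" "wf_digraph H" "strongly_connected H"
        using Hs(1) i len
        by (auto simp: H_def separates_into_def induced_subgraph_def subgraph_def)
      have dec: "separator_decomposition H (us ! i)"
        using list_all2_nthD2[OF Hs(2) i(1)] unfolding H_def by (rule conjunct1)
      have ord: "nested_dissection_order (us ! i) (qs ! i)"
        using list_all2_nthD[OF 1(3) i(1)] .
      have q: "set (qs ! i) = verts H"
        using Union_nodes_separator_decomposition[OF dec] set_nested_dissection_order[OF ord]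
        by simp
      obtain as ps cs where ps: "qs ! i = as @ ps @ cs" "set ps = \<Union>(nodes S)" "linked H (set ps)"
        "\<forall>v\<in>set ps. \<forall>w\<in>verts H - set ps. v \<rightarrow>\<^bsub>H\<^esub> w \<longrightarrow> w \<in> set cs"
        using list_all2_nthD2[OF Hs(2) i(1), THEN conjunct2] ord i(2) H(3,4)
        unfolding H_def by meson
      have "concat qs = concat (take i qs) @ qs ! i @ concat (drop (Suc i) qs)"
        using i len by (metis concat.simps(2) concat_append id_take_nth_drop)
      \<comment> \<open>Siblings visited earlier join the prefix; those visited later, and the
        separator, join the suffix.\<close>
      then have "\<pi> = (concat (take i qs) @ as) @ ps @ (cs @ concat (drop (Suc i) qs) @ xs)"
        using 1(1) ps(1) by simp
      have "linked G (set ps)"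
        using linked_mono ps(3) H(2) by blast
      \<comment> \<open>An arc inside the child's subgraph falls under the induction hypothesis,
        since \<open>H\<close> is induced; any other arc leaving the block ends in
        \<open>X = set xs\<close>.\<close>
      have leaving: "w \<in> set cs \<union> set xs"
        if v: "v \<in> set ps" and w: "w \<in> verts G - set ps" and vw: "v \<rightarrow>\<^bsub>G\<^esub> w" for v w
      proof -
        have vH: "v \<in> verts H"
          using v ps(1) q by auto
        consider "w \<in> X" | j where "j < length us" "w \<in> verts (Hs ! j)"
        proof -
          have "w \<in> X \<or> (\<exists>K\<in>set Hs. w \<in> verts K)"
            using w Hs(1) by (auto simp: separates_into_def)
          then show thesis
            using that len by (auto simp: in_set_conv_nth)
        qed
        then show ?thesis
        proof cases
          case 1
          then show ?thesis
            using \<open>set xs = X\<close> by simp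
        next
          case (2 j)
          have "j = i"
          proof (rule ccontr)
            assume "j \<noteq> i"
            then have "\<not> v \<rightarrow>\<^bsub>G\<^esub> w"
              using Hs(1) vH i(1) len(1) 2 by (simp add: separates_into_def H_def)
            with vw show False
              by contradiction
          qed
          then have wH: "w \<in> verts H"
            using 2 by (simp add: H_def)
          then show ?thesis
            using ps(4) v w induced_subgraph_adj[OF H(1) vH wH vw] by simp
        qed
      qed
      show ?thesis
      proof (intro exI conjI ballI impI)
        show "\<pi> = (concat (take i qs) @ as) @ ps @ (cs @ concat (drop (Suc i) qs) @ xs)"
          by fact
        show "set ps = \<Union>(nodes S)" "linked G (set ps)"
          by fact+
        show "w \<in> set (cs @ concat (drop (Suc i) qs) @ xs)"
          if "v \<in> set ps" "w \<in> verts G - set ps" "v \<rightarrow>\<^bsub>G\<^esub> w" for v w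
          using leaving[OF that] by auto
      qed
    qed
  qed
qed

theorem theorem2:
  fixes G H :: "'a pair_pre_digraph" and T :: "'a set rtree" and \<pi> :: "'a list"
    and X :: "'a set" and ts :: "'a set rtree list" and u :: 'a
  assumes "pair_pseudo_graph G"
    and "strongly_connected (with_proj G)"
    and "separator_decomposition (with_proj G) T"
    and "nested_dissection_order T \<pi>"
    and "H = contraction_graph G \<pi>"
    and "Node X ts \<in> subtrees T"
    and "is_arg_max (Rank \<pi>) (\<lambda>v. v \<in> verts (subtree_graph (with_proj G) (Node X ts))) u"
  shows "boundary G (Node X ts) = up_neighbors H \<pi> u"
proof -
  interpret pair_pseudo_graph G
    by fact
  define P where "P = \<Union>(nodes (Node X ts))"
  define B where "B = boundary G (Node X ts)"
  have B: "B = {w \<in> pverts G - P. \<exists>v\<in>P. (v, w) \<in> parcs G}"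
    by (simp add: B_def P_def boundary_def subtree_graph_def)
  have wf: "wf_digraph (with_proj G)"
    by unfold_locales
  obtain as ps cs where \<pi>: "\<pi> = as @ ps @ cs" and ps: "set ps = P"
    and linked: "linked (with_proj G) P"
    and later: "\<forall>v\<in>P. \<forall>w\<in>pverts G - P. (v, w) \<in> parcs G \<longrightarrow> w \<in> set cs"
    using nested_dissection_order_split[OF assms(3,4,6) wf assms(2)] unfolding P_def by auto
  have dist: "distinct \<pi>"
    using distinct_nested_dissection_order assms(3,4) by blast
  have u: "u \<in> P" and max: "\<And>v. v \<in> P \<Longrightarrow> \<not> Rank \<pi> u < Rank \<pi> v"
    using assms(7) by (auto simp: is_arg_max_def subtree_graph_def P_def)
  obtain p1 p2 where p: "ps = p1 @ u # p2"
    using u ps by (metis split_list)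
  define vs where "vs = as @ p1"
  \<comment> \<open>Maximality of \<open>u\<close> in \<open>P\<close> makes it the last entry of
    the block, so \<open>vs\<close> contains all the rest of \<open>P\<close>.\<close>
  have "Rank \<pi> u < Rank \<pi> y" if "y \<in> set p2" for y
    using Rank_less_append[of "as @ p1 @ [u]" "p2 @ cs" u y] dist that by (simp add: \<pi> p)
  then have "p2 = []"
    using max ps p by (cases p2) auto
  then have \<pi>_eq: "\<pi> = vs @ u # cs" and P: "P - set vs = {u}"
    using \<pi> p ps dist by (auto simp: vs_def)
  have B_later: "B \<subseteq> set cs"
    using later B by auto
  have "enclosed G P B"
    unfolding enclosed_def
  proof (intro conjI ballI allI impI)
    show "sym (parcs G)"
      using sym_arcs by (simp add: symmetric_def)
    show "neighbors G x \<subseteq> P \<union> B" if "x \<in> P" for x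
      using that in_arcsD2 by (auto simp: neighbors_def B)
    show "\<exists>a\<in>A. \<exists>x\<in>insert w P - A. (a, x) \<in> parcs G"
      if "w \<in> B" "A \<subseteq> P" "A \<noteq> {}" for w A
    \<comment> \<open>For \<open>A = P\<close> the arc to \<open>w\<close> comes from the definition
      of the boundary; for a proper subset it comes from \<open>linked\<close>.\<close>
    proof (cases "A = P")
      case True
      then show ?thesis
        using that B by auto
    next
      case False
      then show ?thesis
        using that linked unfolding linked_def by (auto dest!: spec[of _ A])
    qed
  qed
  \<comment> \<open>\<open>B\<close> lies in \<open>set cs\<close>, so no boundary vertex is
    contracted before \<open>u\<close>.\<close>
  then have "enclosed (foldl contract_vertex G vs) {u} B"
    using enclosed_foldl_contract_vertex[of G P B vs] B_later dist P by (auto simp: \<pi>_eq)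
  then have nb: "neighbors (foldl contract_vertex G vs) u - {u} = B"
    using u B by (intro enclosed_singleton) auto
  have arc: "w \<in> neighbors H u \<longleftrightarrow> w \<in> neighbors (foldl contract_vertex G vs) u"
    if "w \<notin> set vs" for w
    using contraction_graph_arc_iff[of u vs w G cs] that dist assms(5)
    by (simp add: \<pi>_eq neighbors_def)
  have "w \<in> B \<longleftrightarrow> w \<in> up_neighbors H \<pi> u" for w
  proof
    assume "w \<in> B"
    then have w: "w \<in> set cs" "w \<notin> set vs"
      using B_later dist by (auto simp: \<pi>_eq)
    then have "Rank \<pi> u < Rank \<pi> w"
      using Rank_less_append[of "vs @ [u]" cs u w] dist by (simp add: \<pi>_eq)
    then show "w \<in> up_neighbors H \<pi> u"
      using arc[OF w(2)] nb \<open>w \<in> B\<close> by (auto simp: up_neighbors_def)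
  next
    assume w: "w \<in> up_neighbors H \<pi> u"
    \<comment> \<open>Vertices of \<open>vs\<close> rank below \<open>u\<close>. The strict rank
      inequality also gives \<open>w \<noteq> u\<close>, which discards a possible loop at
      \<open>u\<close>.\<close>
    then have "w \<notin> set vs"
      using Rank_less_append[of vs "u # cs" w u] dist by (auto simp: up_neighbors_def \<pi>_eq)
    then show "w \<in> B"
      using w arc nb by (auto simp: up_neighbors_def)
  qed
  then show ?thesis
    unfolding B_def by blast
qed

end
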